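(* Let $n\ge p>0$ be integers. For all $U,\widetilde U\in\mathrm{St}(n,p)$, $$d_{\mathrm E}(U,\widetilde U)\ge 2\sqrt p\,\arcsin\left(\frac{\|U-\widetilde U\|_{\mathrm F}}{2\sqrt p}\right).$$
   Context: The Stiefel manifold is $\mathrm{St}(n,p)=\{U\in\mathbb{R}^{n\times p} : U^TU=I_p\}$, and $\|\cdot\|_{\mathrm F}$ is the Frobenius norm. The Euclidean metric on $\mathrm{St}(n,p)$ is the one inherited from $\mathbb{R}^{n\times p}$ with the Frobenius inner product $\langle A,B\rangle_{\mathrm F}=\mathrm{Tr}(A^TB)$. The Euclidean geodesic distance is $d_{\mathrm E}(U,\widetilde U)=\inf_\gamma\int_0^1\|\dot\gamma(t)\|_{\mathrm F}\,dt$, the infimum being over continuously differentiable curves $\gamma:[0,1]\to\mathrm{St}(n,p)$ with $\gamma(0)=U$, $\gamma(1)=\widetilde U$. When $n=p$ the manifold has two connected components, and distances are considered between points of the same component. *)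

theory Defs
  imports "HOL-Analysis.Analysis"
begin

text \<open>An \<open>n \<times> p\<close> real matrix has type \<^typ>\<open>real^'p^'n\<close>, where \<open>n = CARD('n)\<close> and
  \<open>p = CARD('p)\<close>.\<close>

definition frob_inner :: "real^'p^'n \<Rightarrow> real^'p^'n \<Rightarrow> real" where
  "frob_inner A B = trace (transpose A ** B)"

definition frob_norm :: "real^'p^'n \<Rightarrow> real" where
  "frob_norm A = sqrt (frob_inner A A)"

text \<open>The Frobenius structure is the Euclidean one of the library, so its topology and
  derivatives on matrices are those of the Euclidean metric.\<close>

lemma frob_inner_eq_inner: "frob_inner A B = A \<bullet> B"
  unfolding frob_inner_def trace_def transpose_def matrix_matrix_mult_def inner_vec_def
  by (simp, rule sum.swap)

lemma frob_norm_eq_norm: "frob_norm A = norm A"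
  by (simp add: frob_norm_def frob_inner_eq_inner norm_eq_sqrt_inner)

definition stiefel :: "(real^'p^'n) set" where
  "stiefel = {U. transpose U ** U = mat 1}"

text \<open>Derivatives are taken within \<open>{0..1}\<close>, hence one-sided at the end points; values of
  \<open>\<gamma>\<close> outside \<open>{0..1}\<close> are irrelevant.\<close>

definition C1_curve :: "(real \<Rightarrow> 'a::real_normed_vector) \<Rightarrow> bool" where
  "C1_curve \<gamma> \<longleftrightarrow> (\<exists>D. continuous_on {0..1} D \<and>
     (\<forall>t\<in>{0..1}. (\<gamma> has_vector_derivative D t) (at t within {0..1})))"

definition stiefel_curves :: "real^'p^'n \<Rightarrow> real^'p^'n \<Rightarrow> (real \<Rightarrow> real^'p^'n) set" where
  "stiefel_curves U V =
     {\<gamma>. C1_curve \<gamma> \<and> \<gamma> ` {0..1} \<subseteq> stiefel \<and> \<gamma> 0 = U \<and> \<gamma> 1 = V}"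

definition curve_length :: "(real \<Rightarrow> real^'p^'n) \<Rightarrow> real" where
  "curve_length \<gamma> =
     integral {0..1} (\<lambda>t. frob_norm (vector_derivative \<gamma> (at t within {0..1})))"

text \<open>The infimum is taken in the extended reals: it is \<open>\<infinity>\<close> exactly when no curve joins the
  two points (different components, which occurs only for \<open>n = p\<close>), and the ordinary real
  infimum otherwise.\<close>

definition euclidean_geodesic_dist :: "real^'p^'n \<Rightarrow> real^'p^'n \<Rightarrow> ereal" where
  "euclidean_geodesic_dist U V = (INF \<gamma>\<in>stiefel_curves U V. ereal (curve_length \<gamma>))"

end

theory Submission imports Defs begin

text \<open>\<open>St(n,p)\<close> lies on the sphere of radius \<open>\<surd>p\<close>, where a curve is no shorter than the great
  circle arc between its end points. To bound the length of a curve \<open>\<gamma>\<close> on a sphere of radius \<open>r\<close>,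
  differentiate the angle \<open>arccos (\<gamma> t \<bullet> \<gamma> 0 / r\<^sup>2)\<close>. As \<open>arccos\<close> is not differentiable at
  \<open>\<plusminus>1\<close>, its argument is first damped by a factor \<open>c < 1\<close>, and then \<open>c \<rightarrow> 1\<close>.\<close>

text \<open>Replaces the \<open>vector_derivative\<close> in \<open>curve_length\<close> by a given
  continuous derivative \<open>D\<close>: derivatives within a closed interval are unique, and
  continuity of \<open>D\<close> makes its norm integrable, so the length is a genuine integral and
  not a default value.\<close>

lemma C1_curve_length:
  assumes "continuous_on {0..1} D"
    and "\<And>t. t \<in> {0..1} \<Longrightarrow> (\<gamma> has_vector_derivative D t) (at t within {0..1})"
  shows "((\<lambda>t. norm (D t)) has_integral curve_length \<gamma>) {0..1}"
proof -
  have "curve_length \<gamma> = integral {0..1} (\<lambda>t. norm (D t))"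
    unfolding curve_length_def frob_norm_eq_norm
    by (intro integral_cong arg_cong[where f = norm] vector_derivative_within_closed_interval)
      (use assms(2) in auto)
  moreover have "(\<lambda>t. norm (D t)) integrable_on {0..1}"
    by (intro integrable_continuous_real continuous_intros assms(1))
  ultimately show ?thesis
    by (simp add: has_integral_integral)
qed

lemma sphere_curve_orthogonal:
  fixes \<gamma> :: "real \<Rightarrow> 'a::real_inner"
  assumes "a < b" and "t \<in> {a..b}"
    and "(\<gamma> has_vector_derivative d) (at t within {a..b})"
    and "\<And>s. s \<in> {a..b} \<Longrightarrow> norm (\<gamma> s) = r"
  shows "d \<bullet> \<gamma> t = 0"
proof -
  note bounded_bilinear.has_vector_derivative[OF bounded_bilinear_inner assms(3) assms(3)]
  moreover have "r\<^sup>2 = \<gamma> s \<bullet> \<gamma> s" if "s \<in> {a..b}" for s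
    using assms(4)[OF that] by (simp add: power2_norm_eq_inner[symmetric])
  ultimately have "((\<lambda>s. r\<^sup>2) has_vector_derivative (\<gamma> t \<bullet> d + d \<bullet> \<gamma> t)) (at t within {a..b})"
    by (rule has_vector_derivative_transform[OF assms(2), rotated])
  \<comment> \<open>The constant \<open>r\<^sup>2\<close> also has derivative 0, and
    \<open>a < b\<close> makes derivatives within \<open>{a..b}\<close> unique.\<close>
  then have "\<gamma> t \<bullet> d + d \<bullet> \<gamma> t = 0"
    using assms(1,2)
    by (intro vector_derivative_unique_within_closed_interval[OF _ _ _ has_vector_derivative_const])
      simp_all
  then show ?thesis
    by (simp add: inner_commute)
qed

text \<open>Since \<open>d\<close> is orthogonal to \<open>x\<close>, only the component of
  \<open>u\<close> orthogonal to \<open>x\<close> contributes to \<open>d \<bullet> u\<close>. That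
  component has norm \<open>r * sqrt (1 - f\<^sup>2)\<close>, where \<open>f\<close> is the cosine
  of the angle between \<open>x\<close> and \<open>u\<close>, and Cauchy-Schwarz finishes.\<close>

lemma abs_inner_tangent_le:
  fixes x d u :: "'a::real_inner"
  assumes "r > 0" and "norm x = r" and "norm u = r" and "d \<bullet> x = 0"
  shows "\<bar>d \<bullet> u\<bar> \<le> r * norm d * sqrt (1 - (x \<bullet> u / r\<^sup>2)\<^sup>2)"
proof -
  define f where "f = x \<bullet> u / r\<^sup>2"
  have sq: "x \<bullet> x = r\<^sup>2" "u \<bullet> u = r\<^sup>2"
    using assms by (simp_all add: power2_norm_eq_inner[symmetric])
  have xu: "x \<bullet> u = r\<^sup>2 * f"
    using assms(1) by (simp add: f_def)
  have "(norm (u - f *\<^sub>R x))\<^sup>2 = r\<^sup>2 * (1 - f\<^sup>2)"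
    unfolding power2_norm_eq_inner
    by (simp add: inner_diff_left inner_diff_right inner_commute[of u x] sq xu)
      (simp add: algebra_simps power2_eq_square)
  then have "norm (u - f *\<^sub>R x) = sqrt (r\<^sup>2 * (1 - f\<^sup>2))"
    by (metis norm_ge_zero real_sqrt_unique)
  moreover have "d \<bullet> u = d \<bullet> (u - f *\<^sub>R x)"
    using assms(4) by (simp add: inner_diff_right)
  ultimately show ?thesis
    using Cauchy_Schwarz_ineq2[of d "u - f *\<^sub>R x"] assms(1)
    by (simp add: f_def real_sqrt_mult mult_ac)
qed

lemma abs_inner_div_sq_le_1:
  fixes x u :: "'a::real_inner"
  assumes "r > 0" and "norm x = r" and "norm u = r"
  shows "\<bar>x \<bullet> u / r\<^sup>2\<bar> \<le> 1"
  using Cauchy_Schwarz_ineq2[of x u] assms by (simp add: power2_eq_square)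

text \<open>Half-angle formula: a chord subtending the angle \<open>\<theta>\<close> in a circle of
  radius \<open>r\<close> has length \<open>2 * r * sin (\<theta> / 2)\<close>. This turns the angle
  into the form used in the final bound.\<close>

lemma arccos_eq_arcsin_chord:
  fixes x u :: "'a::real_inner"
  assumes "r > 0" and "norm x = r" and "norm u = r"
  shows "arccos (x \<bullet> u / r\<^sup>2) = 2 * arcsin (norm (u - x) / (2 * r))"
proof -
  define \<theta> where "\<theta> = arccos (x \<bullet> u / r\<^sup>2)"
  have bd: "\<bar>x \<bullet> u / r\<^sup>2\<bar> \<le> 1"
    using abs_inner_div_sq_le_1[OF assms] .
  then have \<theta>: "0 \<le> \<theta>" "\<theta> \<le> pi" and cos: "cos \<theta> = x \<bullet> u / r\<^sup>2"
    unfolding \<theta>_def by (auto simp only: abs_le_iff minus_le_iff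
        intro!: arccos_lbound arccos_ubound cos_arccos)
  have "(norm (u - x))\<^sup>2 = 2 * r\<^sup>2 - 2 * (x \<bullet> u)"
    using assms(2,3)
    by (simp add: dot_norm_neg inner_commute norm_minus_commute field_simps)
  also have "x \<bullet> u = r\<^sup>2 * cos (2 * (\<theta> / 2))"
    using assms(1) cos by simp
  also have "2 * r\<^sup>2 - 2 * (r\<^sup>2 * cos (2 * (\<theta> / 2))) = (2 * r * sin (\<theta> / 2))\<^sup>2"
    unfolding cos_double_sin by (simp add: algebra_simps power2_eq_square)
  finally have "(norm (u - x))\<^sup>2 = (2 * r * sin (\<theta> / 2))\<^sup>2" .
  moreover have "0 \<le> sin (\<theta> / 2)"
    using \<theta> by (intro sin_ge_zero) auto
  ultimately have "norm (u - x) = 2 * r * sin (\<theta> / 2)"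
    using assms(1) by (auto intro: power2_eq_imp_eq)
  then have "norm (u - x) / (2 * r) = sin (\<theta> / 2)"
    using assms(1) by simp
  \<comment> \<open>\<open>arcsin\<close> inverts \<open>sin\<close> here because
    \<open>\<theta> / 2\<close> lies between 0 and \<open>pi / 2\<close>.\<close>
  then show ?thesis
    using \<theta> by (simp add: arcsin_sin flip: \<theta>_def)
qed

text \<open>The damped angle to a fixed point \<open>u\<close> of the sphere, scaled by
  \<open>r\<close>, grows at a rate of at most the speed \<open>norm (D t)\<close>; integrating
  gives the bound. The factor \<open>c\<close> keeps the argument of \<open>arccos\<close> strictly
  inside (-1, 1), even where \<open>\<gamma> t\<close> equals \<open>u\<close> or
  \<open>- u\<close>.\<close>

lemma damped_arccos_diff_le:
  fixes \<gamma> :: "real \<Rightarrow> 'a::real_inner"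
  assumes "a < b" and "r > 0" and "0 < c" and "c < 1" and "norm u = r"
    and deriv: "\<And>t. t \<in> {a..b} \<Longrightarrow> (\<gamma> has_vector_derivative D t) (at t within {a..b})"
    and sphere: "\<And>t. t \<in> {a..b} \<Longrightarrow> norm (\<gamma> t) = r"
    and len: "((\<lambda>t. norm (D t)) has_integral L) {a..b}"
  shows "r * (arccos (c * (\<gamma> b \<bullet> u / r\<^sup>2)) - arccos (c * (\<gamma> a \<bullet> u / r\<^sup>2))) \<le> L"
proof -
  define f where "f t = \<gamma> t \<bullet> u / r\<^sup>2" for t
  define g' where "g' t = r * (inverse (- sqrt (1 - (c * f t)\<^sup>2)) * (c * (D t \<bullet> u / r\<^sup>2)))" for t
  have f_le: "\<bar>f t\<bar> \<le> 1" if "t \<in> {a..b}" for t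
    unfolding f_def using abs_inner_div_sq_le_1[OF assms(2) sphere[OF that] assms(5)] .
  have cf: "\<bar>c * f t\<bar> < 1" if "t \<in> {a..b}" for t
  proof -
    have "c * \<bar>f t\<bar> \<le> c * 1"
      using f_le[OF that] assms(3) by (intro mult_left_mono) auto
    also have "\<dots> < 1"
      using assms(4) by simp
    finally show ?thesis
      using assms(3) by (simp add: abs_mult)
  qed
  have "((\<lambda>t. r * arccos (c * f t)) has_vector_derivative g' t) (at t within {a..b})"
    if t: "t \<in> {a..b}" for t
  proof -
    have "(f has_real_derivative (D t \<bullet> u / r\<^sup>2)) (at t within {a..b})"
      using bounded_linear.has_vector_derivative[OF bounded_linear_inner_left deriv[OF t], of u]
      unfolding f_def has_real_derivative_iff_has_vector_derivative[symmetric]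
      by (rule DERIV_cdivide)
    then have "((\<lambda>t. c * f t) has_real_derivative (c * (D t \<bullet> u / r\<^sup>2))) (at t within {a..b})"
      by (rule DERIV_cmult)
    moreover have "(arccos has_real_derivative inverse (- sqrt (1 - (c * f t)\<^sup>2))) (at (c * f t))"
      using cf[OF t] by (intro DERIV_arccos) (auto simp: abs_less_iff)
    ultimately have "((\<lambda>t. arccos (c * f t)) has_real_derivative
        inverse (- sqrt (1 - (c * f t)\<^sup>2)) * (c * (D t \<bullet> u / r\<^sup>2))) (at t within {a..b})"
      by (rule DERIV_chain2[rotated])
    then show ?thesis
      unfolding g'_def has_real_derivative_iff_has_vector_derivative[symmetric]
      by (rule DERIV_cmult)
  qed
  then have "(g' has_integral r * arccos (c * f b) - r * arccos (c * f a)) {a..b}"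
    using assms(1) by (intro fundamental_theorem_of_calculus) auto
  moreover have "g' t \<le> norm (D t)" if t: "t \<in> {a..b}" for t
  proof -
    have pos: "0 < sqrt (1 - (c * f t)\<^sup>2)"
      using cf[OF t] by (simp add: abs_square_less_1)
    have "\<bar>D t \<bullet> u\<bar> \<le> r * norm (D t) * sqrt (1 - (f t)\<^sup>2)"
      unfolding f_def
      by (rule abs_inner_tangent_le[OF assms(2) sphere[OF t] assms(5)
            sphere_curve_orthogonal[OF assms(1) t deriv[OF t] sphere]])
    then have "c * \<bar>D t \<bullet> u\<bar> \<le> c * (r * norm (D t) * sqrt (1 - (f t)\<^sup>2))"
      using assms(3) by simp
    also have "\<dots> = r * norm (D t) * sqrt (c\<^sup>2 * (1 - (f t)\<^sup>2))"
      using assms(3) by (simp add: real_sqrt_mult)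
    \<comment> \<open>As \<open>c\<^sup>2 \<le> 1\<close>, damping costs nothing: \<open>c\<^sup>2 -
      c\<^sup>2 * f\<^sup>2 \<le> 1 - c\<^sup>2 * f\<^sup>2\<close>. The right side is the square of
      the denominator in the derivative of \<open>arccos (c * f t)\<close>.\<close>
    also have "\<dots> \<le> r * norm (D t) * sqrt (1 - (c * f t)\<^sup>2)"
      using assms(2-4) power_le_one[of c 2]
      by (intro mult_left_mono real_sqrt_le_mono) (auto simp: algebra_simps)
    finally have bound: "c * \<bar>D t \<bullet> u\<bar> \<le> r * norm (D t) * sqrt (1 - (c * f t)\<^sup>2)" .
    have "g' t = - (c * (D t \<bullet> u)) / (r * sqrt (1 - (c * f t)\<^sup>2))"
      using assms(2) unfolding g'_def by (simp add: divide_simps power2_eq_square)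
    also have "\<dots> \<le> c * \<bar>D t \<bullet> u\<bar> / (r * sqrt (1 - (c * f t)\<^sup>2))"
      using assms(2,3) pos abs_ge_minus_self[of "c * (D t \<bullet> u)"]
      by (intro divide_right_mono) (auto simp: abs_mult)
    also have "\<dots> \<le> norm (D t)"
      using bound assms(2) pos by (simp add: pos_divide_le_eq mult_ac)
    finally show ?thesis .
  qed
  ultimately have "r * arccos (c * f b) - r * arccos (c * f a) \<le> L"
    using has_integral_le[OF _ len] by blast
  then show ?thesis
    by (simp add: f_def right_diff_distrib)
qed

lemma sphere_curve_length_ge:
  fixes \<gamma> :: "real \<Rightarrow> 'a::real_inner"
  assumes "a < b" and "r > 0"
    and "\<And>t. t \<in> {a..b} \<Longrightarrow> (\<gamma> has_vector_derivative D t) (at t within {a..b})"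
    and sphere: "\<And>t. t \<in> {a..b} \<Longrightarrow> norm (\<gamma> t) = r"
    and "((\<lambda>t. norm (D t)) has_integral L) {a..b}"
  shows "2 * r * arcsin (norm (\<gamma> a - \<gamma> b) / (2 * r)) \<le> L"
proof -
  have ends: "norm (\<gamma> a) = r" "norm (\<gamma> b) = r"
    using sphere assms(1) by auto
  define y where "y = \<gamma> b \<bullet> \<gamma> a / r\<^sup>2"
  define G where "G c = r * (arccos (c * y) - arccos (c * (\<gamma> a \<bullet> \<gamma> a / r\<^sup>2)))" for c
  have aa: "\<gamma> a \<bullet> \<gamma> a / r\<^sup>2 = 1"
    using ends assms(2) by (simp add: power2_norm_eq_inner[symmetric])
  have y: "\<bar>y\<bar> \<le> 1"
    unfolding y_def using abs_inner_div_sq_le_1[OF assms(2) ends(2,1)] .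
  have "-1 \<le> c * y \<and> c * y \<le> 1" if "c \<in> {0..1}" for c
  proof -
    have "\<bar>c * y\<bar> \<le> 1"
      using that y by (simp add: abs_mult mult_le_one)
    then show ?thesis
      by linarith
  qed
  \<comment> \<open>\<open>arccos\<close> is continuous on all of [-1, 1], so the limit at
    \<open>c = 1\<close> exists although differentiability fails at the end points.\<close>
  then have "continuous_on {0..1} G"
    unfolding G_def aa
    by (intro continuous_intros) auto
  then have "(G \<longlongrightarrow> G 1) (at_left 1)"
    by (simp add: continuous_on_Icc_at_leftD)
  moreover have "\<forall>\<^sub>F c in at_left 1. G c \<le> L"
  proof (rule eventually_mono)
    show "\<forall>\<^sub>F c in at_left 1. c \<in> {0<..<1::real}"
      by (rule eventually_at_left_real) simp
    \<comment> \<open>The damped estimate is applied with \<open>u\<close> equal to the starting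
      point \<open>\<gamma> a\<close>; at \<open>c = 1\<close> the subtracted term becomes
      \<open>arccos 1 = 0\<close>.\<close>
    show "G c \<le> L" if "c \<in> {0<..<1}" for c
      unfolding G_def y_def
      using that by (intro damped_arccos_diff_le[OF assms(1,2) _ _ ends(1) assms(3-5)]) simp_all
  qed
  ultimately have "G 1 \<le> L"
    by (rule tendsto_upperbound) simp
  then show ?thesis
    using arccos_eq_arcsin_chord[OF assms(2) ends(2,1)] unfolding G_def aa y_def
    by (simp add: mult_ac)
qed

text \<open>The squared Frobenius norm is the trace of the \<open>p\<close> by \<open>p\<close>
  identity matrix.\<close>

lemma norm_stiefel:
  fixes U :: "real^'p^'n"
  assumes "U \<in> stiefel"
  shows "norm U = sqrt (real CARD('p))"
  using assms
  by (simp add: stiefel_def frob_norm_def frob_inner_def trace_def mat_def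
      flip: frob_norm_eq_norm)

theorem theorem5p3:
  fixes U V :: "real^'p^'n"
  assumes "CARD('p) \<le> CARD('n)"
    and "U \<in> stiefel" and "V \<in> stiefel"
  shows "euclidean_geodesic_dist U V \<ge>
    ereal (2 * sqrt (real CARD('p)) * arcsin (frob_norm (U - V) / (2 * sqrt (real CARD('p)))))"
  unfolding euclidean_geodesic_dist_def
\<comment> \<open>It suffices to bound each connecting curve; if there is none, the infimum is
  infinite and the bound is trivial.\<close>
proof (rule INF_greatest)
  fix \<gamma> assume \<gamma>: "\<gamma> \<in> stiefel_curves U V"
  then have ends: "\<gamma> 0 = U" "\<gamma> 1 = V" and "C1_curve \<gamma>"
    and image: "\<And>t. t \<in> {0..1} \<Longrightarrow> \<gamma> t \<in> stiefel"
    unfolding stiefel_curves_def by blast+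
  then obtain D where D: "continuous_on {0..1} D"
    "\<And>t. t \<in> {0..1} \<Longrightarrow> (\<gamma> has_vector_derivative D t) (at t within {0..1})"
    unfolding C1_curve_def by blast
  have "2 * sqrt (real CARD('p)) * arcsin (norm (\<gamma> 0 - \<gamma> 1) / (2 * sqrt (real CARD('p))))
      \<le> curve_length \<gamma>"
    by (rule sphere_curve_length_ge[OF _ _ D(2) norm_stiefel[OF image] C1_curve_length[OF D]])
      simp_all
  then show "ereal (2 * sqrt (real CARD('p)) *
        arcsin (frob_norm (U - V) / (2 * sqrt (real CARD('p)))))
      \<le> ereal (curve_length \<gamma>)"
    by (simp add: ends frob_norm_eq_norm)
qed

end
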